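(* The class $\mathcal{MF}^*$ of MAT${}^*$-free arrangements is combinatorial.
   Context: Let $\mathbb{k}$ be a field and $V=\mathbb{k}^\ell$. A hyperplane arrangement $\mathcal{A}$ in $V$ is a finite set of (linear) hyperplanes in $V$. Its intersection lattice $L(\mathcal{A})$ is the set of all subspaces $H_1\cap\cdots\cap H_i$ for subsets $\{H_1,\dots,H_i\}\subseteq\mathcal{A}$ (the empty intersection being $V$), partially ordered by reverse inclusion. A class $\mathcal{C}$ of arrangements is called combinatorial if for every $\mathcal{A}\in\mathcal{C}$ and every arrangement $\mathcal{B}$ (possibly over a different field) with $L(\mathcal{B})\cong L(\mathcal{A})$ as lattices, we have $\mathcal{B}\in\mathcal{C}$. For a set $\pi$ of hyperplanes, $\operatorname{rk}(\pi)$ denotes the codimension of $\bigcap_{H\in\pi}H$. For an arrangement $\mathcal{A}'$ and a hyperplane $H\notin\mathcal{A}'$, write $(\mathcal{A}'\cup\{H\})^H=\{H'\cap H\mid H'\in\mathcal{A}'\}$, an arrangement in $H$ (a set, so coincidences are counted once). An arrangement $\mathcal{A}$ is MAT${}^*$-free if there is an ordered partition $\pi=(\pi_1|\cdots|\pi_n)$ of $\mathcal{A}$ into nonempty blocks such that for every $0\le k\le n-1$, with $\mathcal{A}_k:=\bigcup_{i=1}^k\pi_i$ (so $\mathcal{A}_0=\emptyset$), the following hold: (a) $\operatorname{rk}(\pi_{k+1})=|\pi_{k+1}|$; (b* ) $\bigcap_{H\in\pi_{k+1}}H\not\subseteq H'$ for each $H'\in\mathcal{A}_k$; (c) $|\mathcal{A}_k|-|(\mathcal{A}_k\cup\{H\})^H|=k$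 for each $H\in\pi_{k+1}$. The class of MAT${}^*$-free arrangements is denoted $\mathcal{MF}^*$. *)

theory Defs
  imports
    "HOL-Library.Disjoint_Sets"
    "Jordan_Normal_Form.VS_Connect"
begin

text \<open>
  The space of dimension \<open>l\<close> over a field is \<open>carrier_vec l\<close>, so that \<open>l\<close> is an
  arbitrary natural number (including 0) and the field is the element type.
\<close>

definition subspace_of :: "nat \<Rightarrow> 'a::field vec set \<Rightarrow> bool" where
  "subspace_of l W \<longleftrightarrow> VectorSpace.subspace class_ring W (module_vec TYPE('a) l)"

definition subspace_dim :: "nat \<Rightarrow> 'a::field vec set \<Rightarrow> nat" where
  "subspace_dim l W = vectorspace.dim class_ring (module_vec TYPE('a) l\<lparr>carrier := W\<rparr>)"

text \<open>Meaningful for subspaces \<open>W\<close>, where the natural-number subtraction does not truncate.\<close>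

definition codim :: "nat \<Rightarrow> 'a::field vec set \<Rightarrow> nat" where
  "codim l W = l - subspace_dim l W"

definition hyperplane :: "nat \<Rightarrow> 'a::field vec set \<Rightarrow> bool" where
  "hyperplane l H \<longleftrightarrow> subspace_of l H \<and> codim l H = 1"

definition arrangement :: "nat \<Rightarrow> 'a::field vec set set \<Rightarrow> bool" where
  "arrangement l A \<longleftrightarrow> finite A \<and> (\<forall>H\<in>A. hyperplane l H)"

text \<open>Intersecting with \<open>carrier_vec l\<close> makes the empty intersection the whole space.\<close>

definition intersection :: "nat \<Rightarrow> 'a::field vec set set \<Rightarrow> 'a vec set" where
  "intersection l S = carrier_vec l \<inter> \<Inter>S"

definition intersection_lattice :: "nat \<Rightarrow> 'a::field vec set set \<Rightarrow> 'a vec set set" where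
  "intersection_lattice l A = {intersection l S | S. S \<subseteq> A}"

text \<open>
  Isomorphism of families of sets ordered by reverse inclusion. A bijection between lattices is a
  lattice isomorphism precisely if it preserves and reflects the order.
\<close>

definition lattice_isomorphic :: "'a set set \<Rightarrow> 'b set set \<Rightarrow> bool" where
  "lattice_isomorphic L M \<longleftrightarrow>
     (\<exists>f. bij_betw f L M \<and> (\<forall>X\<in>L. \<forall>Y\<in>L. X \<supseteq> Y \<longleftrightarrow> f X \<supseteq> f Y))"

definition rk :: "nat \<Rightarrow> 'a::field vec set set \<Rightarrow> nat" where
  "rk l S = codim l (intersection l S)"

text \<open>\<open>restriction A H\<close> is the restriction of \<open>A \<union> {H}\<close> to \<open>H\<close>, for \<open>H \<notin> A\<close>.\<close>

definition restriction :: "'a vec set set \<Rightarrow> 'a vec set \<Rightarrow> 'a vec set set" where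
  "restriction A H = {H' \<inter> H | H'. H' \<in> A}"

definition ordered_partition :: "'a set \<Rightarrow> 'a set list \<Rightarrow> bool" where
  "ordered_partition A p \<longleftrightarrow> distinct p \<and> partition_on A (set p)"

text \<open>
  Blocks are indexed from 0, so \<open>p ! k\<close> is the \<open>(k+1)\<close>-st block and \<open>\<Union>(set (take k p))\<close> is the
  union of the first \<open>k\<close> blocks.
\<close>

definition mat_star_partition :: "nat \<Rightarrow> 'a::field vec set set \<Rightarrow> 'a vec set set list \<Rightarrow> bool" where
  "mat_star_partition l A p \<longleftrightarrow> ordered_partition A p \<and>
     (\<forall>k < length p.
        let Ak = \<Union>(set (take k p)) in
        rk l (p ! k) = card (p ! k) \<and>
        (\<forall>H'\<in>Ak. \<not> intersection l (p ! k) \<subseteq> H') \<and>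
        (\<forall>H\<in>p ! k. int (card Ak) - int (card (restriction Ak H)) = int k))"

definition mat_star_free :: "nat \<Rightarrow> 'a::field vec set set \<Rightarrow> bool" where
  "mat_star_free l A \<longleftrightarrow> arrangement l A \<and> (\<exists>p. mat_star_partition l A p)"

end

theory Submission
  imports Defs
begin

text \<open>
  The hyperplanes are the elements of the lattice that are maximal among the proper ones, so a
  lattice isomorphism carries one arrangement onto the other, and it commutes with intersections
  because these are the meets. Hence conditions (b*) and (c) transfer. For (a), intersecting with a
  hyperplane raises the codimension by exactly one unless nothing changes, so a block has rank equal
  to its size precisely if none of its members contains the intersection of the others, and this
  again only refers to the lattice.
\<close>

section \<open>Dimensions of subspaces of a finite-dimensional vector space\<close>

context vectorspace
begin

text \<open>Take \<open>b\<close> to be a maximal independent subset of \<open>W\<close>. Both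
  independence and span are expressed in the ambient space, so that bases of different subspaces can
  be compared and extended there.\<close>

lemma subspace_basis:
  assumes fd: "fin_dim" and W: "subspace K W V"
  obtains b where "finite b" "b \<subseteq> W" "lin_indpt b" "span b = W" "vectorspace.dim K (vs W) = card b"
proof -
  interpret W: vectorspace K "vs W" using W by (rule subspace_is_vs)
  have sub: "submodule K W V" using W by simp
  have WV: "W \<subseteq> carrier V" using sub by (simp add: submodule_def)
  \<comment> \<open>The uniform bound that guarantees a maximal set: independence inside
    \<open>W\<close> agrees with independence in \<open>V\<close>, where \<open>dim\<close> limits
    the size.\<close>
  have *: "finite S \<and> card S \<le> dim" if "S \<subseteq> carrier (vs W) \<and> W.lin_indpt S" for S
  proof -
    have S: "S \<subseteq> W" using that by simp
    have "lin_indpt S" using that span_li_not_depend(2)[OF S sub] by simp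
    then show ?thesis using li_le_dim[OF fd] S WV by blast
  qed
  have "{} \<subseteq> carrier (vs W) \<and> W.lin_indpt {}" by (auto simp: W.lin_dep_def)
  then have "\<exists>b. finite b \<and> maximal b (\<lambda>S. S \<subseteq> carrier (vs W) \<and> W.lin_indpt S)"
    by - (intro maximal_exists[where N = dim and B = "{}"] *; assumption)
  then obtain b where b: "finite b" "maximal b (\<lambda>S. S \<subseteq> carrier (vs W) \<and> W.lin_indpt S)"
    by blast
  have basis: "W.basis b" using b(2) by (rule W.max_li_is_basis)
  then have bW: "b \<subseteq> W" by (simp add: W.basis_def)
  show thesis
  proof
    show "finite b" "b \<subseteq> W" by fact+
    show "lin_indpt b" using basis span_li_not_depend(2)[OF bW sub] by (simp add: W.basis_def)
    show "span b = W" using basis span_li_not_depend(1)[OF bW sub] by (simp add: W.basis_def)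
    show "W.dim = card b" using W.dim_basis[OF b(1) basis] .
  qed
qed

lemma subspace_dim_eq_card:
  assumes W: "subspace K W V" and b: "finite b" "b \<subseteq> carrier V" "lin_indpt b" "span b = W"
  shows "vectorspace.dim K (vs W) = card b"
proof -
  interpret W: vectorspace K "vs W" using W by (rule subspace_is_vs)
  have sub: "submodule K W V" using W by simp
  have bW: "b \<subseteq> W" using in_own_span[OF b(2)] b(4) by simp
  have "W.basis b"
    using b bW span_li_not_depend[OF bW sub] by (simp add: W.basis_def)
  then show ?thesis using W.dim_basis b(1) by blast
qed

lemma subspace_dim_le:
  assumes "fin_dim" "subspace K W V"
  shows "vectorspace.dim K (vs W) \<le> dim"
proof -
  obtain b where b: "b \<subseteq> W" "lin_indpt b" "vectorspace.dim K (vs W) = card b"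
    using subspace_basis[OF assms] by metis
  moreover have "W \<subseteq> carrier V" using assms(2) by (simp add: subspace_def submodule_def)
  ultimately show ?thesis using li_le_dim(2)[OF assms(1)] by (metis subset_trans)
qed

lemma subspace_Int:
  assumes "subspace K U V" "subspace K W V"
  shows "subspace K (U \<inter> W) V"
  using assms by (auto simp: subspace_def submodule_def)

text \<open>A basis of \<open>U\<close> becomes a basis of \<open>W\<close> once \<open>w\<close> is
  added: it stays independent because \<open>w\<close> is outside the span \<open>U\<close>, and it
  spans by \<open>decomp\<close>.\<close>

lemma subspace_dim_Suc:
  assumes fd: "fin_dim" and U: "subspace K U V" and W: "subspace K W V"
    and UW: "U \<subseteq> W" and w: "w \<in> W" "w \<notin> U"
    and decomp: "\<And>x. x \<in> W \<Longrightarrow> \<exists>u\<in>U. \<exists>c\<in>carrier K. x = c \<odot>\<^bsub>V\<^esub> w \<oplus>\<^bsub>V\<^esub> u"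
  shows "vectorspace.dim K (vs W) = Suc (vectorspace.dim K (vs U))"
proof -
  have sub: "submodule K W V" using W by simp
  have WV: "W \<subseteq> carrier V" using sub by (simp add: submodule_def)
  obtain b where b: "finite b" "b \<subseteq> U" "lin_indpt b" "span b = U"
      "vectorspace.dim K (vs U) = card b"
    using subspace_basis[OF fd U] .
  have bV: "b \<subseteq> carrier V" and wV: "w \<in> carrier V" using b(2) UW WV w by auto
  have wb: "w \<notin> b" using b(2) w by auto
  have li: "lin_indpt (b \<union> {w})"
    using lin_dep_iff_in_span[OF bV b(3) wV wb] b(4) w(2) by simp
  have bwV: "b \<union> {w} \<subseteq> carrier V" using bV wV by simp
  have "W \<subseteq> span (b \<union> {w})"
  proof
    fix x assume "x \<in> W"
    then obtain u c where u: "u \<in> U" "c \<in> carrier K" "x = c \<odot>\<^bsub>V\<^esub> w \<oplus>\<^bsub>V\<^esub> u" using decomp by blast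
    have S: "submodule K (span (b \<union> {w})) V" using bwV by (rule span_is_submodule)
    have "u \<in> span (b \<union> {w})" using u(1) b(4) span_is_monotone[of b "b \<union> {w}"] by auto
    moreover have "w \<in> span (b \<union> {w})" using span_mem[OF bwV] by simp
    ultimately show "x \<in> span (b \<union> {w})" using S u(2,3) by (simp add: submodule_def)
  qed
  moreover have "span (b \<union> {w}) \<subseteq> W"
    using b(2) UW w(1) by (intro span_is_subset[OF _ sub]) auto
  ultimately have "vectorspace.dim K (vs W) = card (b \<union> {w})"
    using b(1) by (intro subspace_dim_eq_card[OF W _ bwV li]) auto
  then show ?thesis using b(1,5) wb by simp
qed

text \<open>A basis of \<open>H\<close> together with \<open>w\<close> is independent and has
  \<open>dim\<close> elements, so it is a basis of \<open>V\<close>. Splitting off the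
  \<open>w\<close> term of a linear combination leaves the part in \<open>H\<close>.\<close>

lemma hyperplane_decomp:
  assumes fd: "fin_dim" and H: "subspace K H V" and dim: "dim = Suc (vectorspace.dim K (vs H))"
    and w: "w \<in> carrier V" "w \<notin> H" and x: "x \<in> carrier V"
  shows "\<exists>h\<in>H. \<exists>c\<in>carrier K. x = c \<odot>\<^bsub>V\<^esub> w \<oplus>\<^bsub>V\<^esub> h"
proof -
  obtain b where b: "finite b" "b \<subseteq> H" "lin_indpt b" "span b = H"
      "vectorspace.dim K (vs H) = card b"
    using subspace_basis[OF fd H] .
  have HV: "H \<subseteq> carrier V" using H by (simp add: subspace_def submodule_def)
  have bV: "b \<subseteq> carrier V" and wb: "w \<notin> b" using b(2) HV w by auto
  have li: "lin_indpt (b \<union> {w})"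
    using lin_dep_iff_in_span[OF bV b(3) w(1) wb] b(4) w(2) by simp
  have bwV: "b \<union> {w} \<subseteq> carrier V" using bV w by simp
  have "basis (b \<union> {w})"
    using b(1,5) wb dim by (intro dim_li_is_basis[OF fd _ bwV li]) auto
  then have "x \<in> span (b \<union> {w})" using x by (simp add: basis_def)
  then obtain a where a: "a \<in> b \<union> {w} \<rightarrow> carrier K" "lincomb a (b \<union> {w}) = x"
    using finite_in_span[OF _ bwV] b(1) by auto
  have "x = a w \<odot>\<^bsub>V\<^esub> w \<oplus>\<^bsub>V\<^esub> lincomb a b"
    using lincomb_insert[OF b(1) bV _ wb w(1)] a by simp
  moreover have "lincomb a b \<in> H"
    unfolding b(4)[symmetric] using finite_span[OF b(1) bV] a(1) by auto
  ultimately show ?thesis using a(1) by auto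
qed

text \<open>Choose \<open>w\<close> in \<open>W\<close> outside \<open>H\<close> and decompose the
  vectors of \<open>W\<close> along \<open>w\<close> and \<open>H\<close>. The component in
  \<open>H\<close> automatically lies in \<open>W\<close> too, so \<open>w\<close> and
  \<open>W \<inter> H\<close> together generate \<open>W\<close>.\<close>

lemma dim_Int_hyperplane:
  assumes fd: "fin_dim" and H: "subspace K H V" and dim: "dim = Suc (vectorspace.dim K (vs H))"
    and W: "subspace K W V" and WH: "\<not> W \<subseteq> H"
  shows "vectorspace.dim K (vs W) = Suc (vectorspace.dim K (vs (W \<inter> H)))"
proof -
  obtain w where w: "w \<in> W" "w \<notin> H" using WH by blast
  have sub: "submodule K W V" using W by simp
  then have WV: "W \<subseteq> carrier V" by (simp add: submodule_def)
  have HV: "H \<subseteq> carrier V" using H by (simp add: subspace_def submodule_def)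
  show ?thesis
  proof (rule subspace_dim_Suc[OF fd subspace_Int[OF W H] W])
    fix x assume x: "x \<in> W"
    then obtain h c where h: "h \<in> H" "c \<in> carrier K" "x = c \<odot>\<^bsub>V\<^esub> w \<oplus>\<^bsub>V\<^esub> h"
      using hyperplane_decomp[OF fd H dim _ w(2)] w(1) WV by blast
    have cw: "c \<odot>\<^bsub>V\<^esub> w \<in> W" using sub h(2) w(1) by (simp add: submodule_def)
    \<comment> \<open>Solving for \<open>h\<close> exhibits it as a difference of two elements of
      \<open>W\<close>.\<close>
    have "h = \<ominus>\<^bsub>V\<^esub> (c \<odot>\<^bsub>V\<^esub> w) \<oplus>\<^bsub>V\<^esub> x"
      unfolding h(3) using cw WV h(1) HV by (intro M.r_neg1[symmetric]) auto
    \<comment> \<open>The negative is rewritten as multiplication of \<open>w\<close> by the negated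
      scalar, under which submodules are closed.\<close>
    moreover have "\<ominus>\<^bsub>V\<^esub> (c \<odot>\<^bsub>V\<^esub> w) \<in> W"
      using sub cw WV h(2) w(1) by (simp add: submodule_def smult_l_minus[symmetric] subset_iff)
    ultimately have "h \<in> W" using sub x by (simp add: submodule_def)
    then show "\<exists>u\<in>W \<inter> H. \<exists>c\<in>carrier K. x = c \<odot>\<^bsub>V\<^esub> w \<oplus>\<^bsub>V\<^esub> u" using h by blast
  qed (use w in auto)
qed

end

section \<open>Codimension and hyperplanes in \<open>carrier_vec l\<close>\<close>

lemma subspace_of_Int: "subspace_of l U \<Longrightarrow> subspace_of l W \<Longrightarrow> subspace_of l (U \<inter> W)"
  unfolding subspace_of_def by (rule vectorspace.subspace_Int[OF vec_vs])

lemma subspace_of_subset: "subspace_of l W \<Longrightarrow> W \<subseteq> carrier_vec l"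
  by (simp add: subspace_of_def VectorSpace.subspace_def submodule_def module_vec_simps)

lemma subspace_of_carrier: "subspace_of l (carrier_vec l :: 'a::field vec set)"
proof -
  interpret vec_space "TYPE('a)" l .
  show ?thesis
    using vec_vs[where 'a='a and n=l] module_axioms unfolding subspace_of_def VectorSpace.subspace_def submodule_def
    by auto
qed

text \<open>Ensures that the subtraction in \<open>codim\<close> does not truncate on
  subspaces.\<close>

lemma subspace_dim_le_ambient:
  fixes W :: "'a::field vec set"
  assumes "subspace_of l W"
  shows "subspace_dim l W \<le> l"
proof -
  interpret vec_space "TYPE('a)" l .
  show ?thesis
    using subspace_dim_le[OF fin_dim] assms by (simp add: subspace_of_def subspace_dim_def dim_is_n)
qed

lemma codim_carrier: "codim l (carrier_vec l :: 'a::field vec set) = 0"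
proof -
  interpret vec_space "TYPE('a)" l .
  have "V\<lparr>carrier := carrier_vec l\<rparr> = V" by (simp add: module_vec_def)
  then have "subspace_dim l (carrier_vec l :: 'a vec set) = l"
    unfolding subspace_dim_def by (simp only: dim_is_n)
  then show ?thesis by (simp add: codim_def)
qed

lemma codim_Int_hyperplane:
  fixes W :: "'a::field vec set"
  assumes H: "hyperplane l H" and W: "subspace_of l W" and WH: "\<not> W \<subseteq> H"
  shows "codim l (W \<inter> H) = Suc (codim l W)"
proof -
  interpret vec_space "TYPE('a)" l .
  \<comment> \<open>Even with truncated subtraction, a difference equal to 1 determines
    \<open>l\<close> exactly.\<close>
  have "l = Suc (subspace_dim l H)"
    using H by (auto simp: hyperplane_def codim_def)
  then have "subspace_dim l W = Suc (subspace_dim l (W \<inter> H))"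
    unfolding subspace_dim_def
    using dim_Int_hyperplane[OF fin_dim] H W WH by (simp add: dim_is_n hyperplane_def subspace_of_def)
  then show ?thesis using subspace_dim_le_ambient[OF W] by (simp add: codim_def)
qed

lemma hyperplane_subset_carrier: "hyperplane l H \<Longrightarrow> H \<subseteq> carrier_vec l"
  by (simp add: hyperplane_def subspace_of_subset)

lemma hyperplane_neq_carrier: "hyperplane l H \<Longrightarrow> H \<noteq> carrier_vec l"
  by (auto simp: hyperplane_def codim_carrier)

text \<open>If the inclusion were proper, cutting \<open>H'\<close> with \<open>H\<close> would
  yield \<open>H\<close> itself in codimension 2.\<close>

lemma hyperplane_subset_imp_eq:
  assumes "hyperplane l H" "hyperplane l H'" "H \<subseteq> H'"
  shows "H = H'"
proof (rule ccontr)
  assume "H \<noteq> H'"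
  then have "codim l (H' \<inter> H) = Suc (codim l H')"
    using assms by (intro codim_Int_hyperplane) (auto simp: hyperplane_def)
  moreover have "H' \<inter> H = H" using assms(3) by blast
  ultimately show False using assms(1,2) by (simp add: hyperplane_def)
qed

section \<open>Intersections and rank\<close>

lemma intersection_empty [simp]: "intersection l {} = carrier_vec l"
  by (simp add: intersection_def)

lemma intersection_insert: "intersection l (insert H S) = intersection l S \<inter> H"
  by (auto simp: intersection_def)

lemma subspace_of_intersection:
  assumes "finite S" "\<forall>H\<in>S. hyperplane l H"
  shows "subspace_of l (intersection l S)"
  using assms by (induction S rule: finite_induct)
    (auto simp: subspace_of_carrier intersection_insert subspace_of_Int hyperplane_def)

lemma arrangement_subset: "arrangement l A \<Longrightarrow> S \<subseteq> A \<Longrightarrow> arrangement l S"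
  by (auto simp: arrangement_def intro: finite_subset)

text \<open>Either the intersection is unchanged or it is cut by a hyperplane not containing it. The
  later inductions on the rank rest on this dichotomy.\<close>

lemma rk_insert:
  assumes "arrangement l (insert H S)"
  shows "rk l (insert H S) = (if intersection l S \<subseteq> H then rk l S else Suc (rk l S))"
proof (cases "intersection l S \<subseteq> H")
  case False
  have "finite S" "hyperplane l H" "\<forall>H\<in>S. hyperplane l H" using assms by (auto simp: arrangement_def)
  then show ?thesis
    using False by (simp add: rk_def intersection_insert codim_Int_hyperplane subspace_of_intersection)
qed (simp add: rk_def intersection_insert Int_absorb2)

lemma rk_le_card:
  assumes "arrangement l S"
  shows "rk l S \<le> card S"
proof -
  have "finite S" using assms by (simp add: arrangement_def)
  then show ?thesis using assms
  proof (induction S rule: finite_induct)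
    case (insert H S)
    then have "rk l S \<le> card S" using arrangement_subset by blast
    with insert show ?case by (simp add: rk_insert)
  qed (simp add: rk_def codim_carrier)
qed

text \<open>Turns condition (a) into a statement about inclusions alone. A hyperplane containing the
  intersection of the others could be dropped without changing the rank, leaving too few hyperplanes
  to reach it; without such a hyperplane, each insertion raises the rank by one.\<close>

lemma rk_eq_card_iff:
  assumes "arrangement l S"
  shows "rk l S = card S \<longleftrightarrow> (\<forall>H\<in>S. \<not> intersection l (S - {H}) \<subseteq> H)"
proof
  assume eq: "rk l S = card S"
  show "\<forall>H\<in>S. \<not> intersection l (S - {H}) \<subseteq> H"
  proof (intro ballI notI)
    fix H assume H: "H \<in> S" "intersection l (S - {H}) \<subseteq> H"
    then have "rk l S = rk l (S - {H})"
      using rk_insert[of l H "S - {H}"] assms by (simp add: insert_absorb)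
    also have "\<dots> \<le> card (S - {H})"
      using assms by (intro rk_le_card) (auto intro: arrangement_subset)
    also have "\<dots> < card S"
      using H assms by (intro card_Diff1_less) (auto simp: arrangement_def)
    finally show False using eq by simp
  qed
next
  have "finite S" using assms by (simp add: arrangement_def)
  moreover assume "\<forall>H\<in>S. \<not> intersection l (S - {H}) \<subseteq> H"
  ultimately show "rk l S = card S" using assms
  proof (induction S rule: finite_induct)
    case (insert H S)
    \<comment> \<open>The hypothesis is inherited by subsets, since intersecting fewer hyperplanes
      gives a larger space.\<close>
    have "\<not> intersection l (S - {H'}) \<subseteq> H'" if "H' \<in> S" for H'
    proof -
      have "intersection l (insert H S - {H'}) \<subseteq> intersection l (S - {H'})"
        by (auto simp: intersection_def)
      then show ?thesis using insert.prems(1) that by blast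
    qed
    moreover have "arrangement l S" using insert.prems(2) by (rule arrangement_subset) blast
    ultimately have "rk l S = card S" using insert.IH by blast
    moreover have "\<not> intersection l S \<subseteq> H" using insert by simp
    ultimately show ?case using insert by (simp add: rk_insert)
  qed (simp add: rk_def codim_carrier)
qed

section \<open>The intersection lattice and its atoms\<close>

lemma carrier_in_lattice: "carrier_vec l \<in> intersection_lattice l A"
  by (auto simp: intersection_lattice_def intro: exI[of _ "{}"])

lemma arrangement_subset_lattice:
  assumes "arrangement l A"
  shows "A \<subseteq> intersection_lattice l A"
proof
  fix H assume H: "H \<in> A"
  then have "H = intersection l {H}"
    using assms hyperplane_subset_carrier by (force simp: arrangement_def intersection_def)
  with H show "H \<in> intersection_lattice l A" by (auto simp: intersection_lattice_def)
qed

lemma lattice_subset_carrier: "X \<in> intersection_lattice l A \<Longrightarrow> X \<subseteq> carrier_vec l"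
  by (auto simp: intersection_lattice_def intersection_def)

text \<open>Recovers the hyperplanes from the order: they are the atoms for reverse inclusion. A
  lattice element other than the whole space lies in some hyperplane of \<open>A\<close>, and
  hyperplanes do not contain each other properly.\<close>

lemma in_arrangement_iff_atom:
  assumes A: "arrangement l A" and H: "H \<in> intersection_lattice l A"
  shows "H \<in> A \<longleftrightarrow> H \<noteq> carrier_vec l \<and>
    (\<forall>X\<in>intersection_lattice l A. H \<subseteq> X \<longrightarrow> X = H \<or> X = carrier_vec l)"
proof (intro iffI conjI ballI impI)
  assume HA: "H \<in> A"
  then have hyp: "hyperplane l H" using A by (simp add: arrangement_def)
  then show "H \<noteq> carrier_vec l" by (rule hyperplane_neq_carrier)
  fix X assume "X \<in> intersection_lattice l A" and HX: "H \<subseteq> X"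
  then obtain S where S: "S \<subseteq> A" "X = intersection l S" by (auto simp: intersection_lattice_def)
  show "X = H \<or> X = carrier_vec l"
  proof (cases "S = {}")
    case False
    then obtain H' where H': "H' \<in> S" by blast
    then have XH': "X \<subseteq> H'" using S(2) by (auto simp: intersection_def)
    have "hyperplane l H'" using H' S(1) A by (auto simp: arrangement_def)
    then have "H = H'" using hyperplane_subset_imp_eq[OF hyp] HX XH' by blast
    then show ?thesis using HX XH' by blast
  qed (use S in simp)
next
  assume *: "H \<noteq> carrier_vec l \<and>
    (\<forall>X\<in>intersection_lattice l A. H \<subseteq> X \<longrightarrow> X = H \<or> X = carrier_vec l)"
  obtain S where S: "S \<subseteq> A" "H = intersection l S" using H by (auto simp: intersection_lattice_def)
  \<comment> \<open>\<open>S\<close> is nonempty because its intersection is not the whole space; by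
    the maximality of \<open>H\<close>, the member \<open>H'\<close> must turn out to be
    \<open>H\<close>.\<close>
  with * obtain H' where H': "H' \<in> S" by fastforce
  then have "H \<subseteq> H'" "H' \<in> A" using S by (auto simp: intersection_def)
  moreover have "H' \<noteq> carrier_vec l"
    using \<open>H' \<in> A\<close> A hyperplane_neq_carrier by (auto simp: arrangement_def)
  ultimately show "H \<in> A" using * arrangement_subset_lattice[OF A] by auto
qed

section \<open>Transport along a lattice isomorphism\<close>

lemma lattice_isomorphic_sym:
  assumes "lattice_isomorphic L M"
  shows "lattice_isomorphic M L"
proof -
  obtain f where f: "bij_betw f L M" and ord: "\<forall>X\<in>L. \<forall>Y\<in>L. X \<supseteq> Y \<longleftrightarrow> f X \<supseteq> f Y"
    using assms by (auto simp: lattice_isomorphic_def)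
  have "inv_into L f X \<in> L \<and> f (inv_into L f X) = X" if "X \<in> M" for X
    using f that by (metis bij_betw_imp_surj_on f_inv_into_f inv_into_into)
  then have "\<forall>X\<in>M. \<forall>Y\<in>M. X \<supseteq> Y \<longleftrightarrow> inv_into L f X \<supseteq> inv_into L f Y"
    using ord by metis
  then show ?thesis
    using bij_betw_inv_into[OF f] by (auto simp: lattice_isomorphic_def)
qed

text \<open>The map goes from the lattice of \<open>A\<close> to that of \<open>B\<close>, the
  direction in which a partition of \<open>A\<close> is pushed forward. Fields and ambient
  dimensions may differ.\<close>

locale arrangement_iso =
  fixes l m :: nat and A :: "'a::field vec set set" and B :: "'b::field vec set set"
    and g :: "'a vec set \<Rightarrow> 'b vec set"
  assumes A: "arrangement l A" and B: "arrangement m B"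
    and bij: "bij_betw g (intersection_lattice l A) (intersection_lattice m B)"
    and ord: "\<lbrakk>X \<in> intersection_lattice l A; Y \<in> intersection_lattice l A\<rbrakk>
      \<Longrightarrow> g X \<subseteq> g Y \<longleftrightarrow> X \<subseteq> Y"
begin

abbreviation "L \<equiv> intersection_lattice l A"
abbreviation "M \<equiv> intersection_lattice m B"

lemma image_lattice: "g ` L = M"
  using bij by (rule bij_betw_imp_surj_on)

lemma image_eq_iff: "X \<in> L \<Longrightarrow> Y \<in> L \<Longrightarrow> g X = g Y \<longleftrightarrow> X = Y"
  using bij by (auto simp: bij_betw_def inj_on_def)

lemma AL: "A \<subseteq> L"
  using A by (rule arrangement_subset_lattice)

lemma inj_on_A: "inj_on g A"
  using bij AL by (auto simp: bij_betw_def intro: inj_on_subset)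

text \<open>The whole space is the greatest element under inclusion on either side.\<close>

lemma image_carrier: "g (carrier_vec l) = carrier_vec m"
proof -
  have C: "carrier_vec l \<in> L" by (rule carrier_in_lattice)
  have "carrier_vec m \<in> g ` L" unfolding image_lattice by (rule carrier_in_lattice)
  then obtain X where X: "X \<in> L" "carrier_vec m = g X" by blast
  then have "carrier_vec m \<subseteq> g (carrier_vec l)"
    using ord[OF X(1) C] lattice_subset_carrier[OF X(1)] by simp
  moreover have "g (carrier_vec l) \<subseteq> carrier_vec m"
    using C image_lattice by (intro lattice_subset_carrier[of _ m B]) blast
  ultimately show ?thesis by blast
qed

text \<open>The atom criterion mentions only the order and the whole space, both of which
  \<open>g\<close> respects.\<close>

lemma image_in_B_iff:
  assumes H: "H \<in> L"
  shows "g H \<in> B \<longleftrightarrow> H \<in> A"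
proof -
  have C: "carrier_vec l \<in> L" by (rule carrier_in_lattice)
  have gH: "g H \<in> M" using H image_lattice by blast
  have "g H \<in> B \<longleftrightarrow> g H \<noteq> g (carrier_vec l) \<and>
      (\<forall>X\<in>L. g H \<subseteq> g X \<longrightarrow> g X = g H \<or> g X = g (carrier_vec l))"
    \<comment> \<open>The quantifier over \<open>M\<close> becomes one over \<open>L\<close> because
      \<open>M\<close> is the image of \<open>L\<close>.\<close>
    unfolding in_arrangement_iff_atom[OF B gH] by (simp add: image_carrier flip: image_lattice)
  also have "\<dots> \<longleftrightarrow> H \<in> A"
    unfolding in_arrangement_iff_atom[OF A H] using H C by (simp add: ord image_eq_iff)
  finally show ?thesis .
qed

lemma image_arrangement: "g ` A = B"
proof
  show "g ` A \<subseteq> B" using image_in_B_iff AL by blast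
  show "B \<subseteq> g ` A"
  proof
    fix K assume K: "K \<in> B"
    then obtain X where "X \<in> L" "K = g X"
      using arrangement_subset_lattice[OF B] image_lattice by blast
    then show "K \<in> g ` A" using K image_in_B_iff by blast
  qed
qed

lemma intersection_in_L: "S \<subseteq> A \<Longrightarrow> intersection l S \<in> L"
  by (auto simp: intersection_lattice_def)

text \<open>Within the lattice, an intersection is the greatest lower bound of its members under
  inclusion, and order isomorphisms preserve such bounds.\<close>

lemma image_intersection:
  assumes S: "S \<subseteq> A"
  shows "g (intersection l S) = intersection m (g ` S)"
proof
  have IL: "intersection l S \<in> L" using S by (rule intersection_in_L)
  have "g (intersection l S) \<subseteq> g H" if "H \<in> S" for H
    using that S AL IL by (subst ord) (auto simp: intersection_def)
  moreover have "g (intersection l S) \<in> M" using IL image_lattice by blast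
  then have "g (intersection l S) \<subseteq> carrier_vec m" by (rule lattice_subset_carrier)
  ultimately show "g (intersection l S) \<subseteq> intersection m (g ` S)"
    by (auto simp: intersection_def)
  have "intersection m (g ` S) \<in> M"
    using S image_arrangement by (auto simp: intersection_lattice_def)
  \<comment> \<open>Pulling the intersection on the side of \<open>B\<close> back to
    \<open>X\<close> gives a lower bound of \<open>S\<close> in \<open>L\<close>, hence a subset of
    \<open>intersection l S\<close>.\<close>
  then obtain X where X: "X \<in> L" "intersection m (g ` S) = g X" using image_lattice by blast
  have "X \<subseteq> H" if "H \<in> S" for H
  proof -
    have "g X \<subseteq> g H" unfolding X(2)[symmetric] using that by (auto simp: intersection_def)
    then show ?thesis using ord[OF X(1)] that S AL by blast
  qed
  then have "X \<subseteq> intersection l S"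
    using lattice_subset_carrier[OF X(1)] by (auto simp: intersection_def)
  then show "intersection m (g ` S) \<subseteq> g (intersection l S)" using X ord[OF X(1) IL] by simp
qed

lemma image_intersection_subset_iff:
  "S \<subseteq> A \<Longrightarrow> H \<in> A \<Longrightarrow> intersection m (g ` S) \<subseteq> g H \<longleftrightarrow> intersection l S \<subseteq> H"
  using AL by (subst image_intersection[symmetric]) (auto intro!: ord intersection_in_L)

lemma card_image_block: "S \<subseteq> A \<Longrightarrow> card (g ` S) = card S"
  by (intro card_image inj_on_subset[OF inj_on_A])

lemma rk_image_eq_card_iff:
  assumes S: "S \<subseteq> A"
  shows "rk m (g ` S) = card (g ` S) \<longleftrightarrow> rk l S = card S"
proof -
  have "intersection m (g ` S - {g H}) \<subseteq> g H \<longleftrightarrow> intersection l (S - {H}) \<subseteq> H" if "H \<in> S" for H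
  proof -
    \<comment> \<open>Injectivity on \<open>A\<close> lets removal of a hyperplane commute with
      taking images.\<close>
    have "g ` S - {g H} = g ` (S - {H})"
      using inj_on_image_set_diff[OF inj_on_A, of S "{H}"] that S by auto
    moreover have "S - {H} \<subseteq> A" "H \<in> A" using S that by auto
    ultimately show ?thesis using image_intersection_subset_iff[of "S - {H}" H] by simp
  qed
  moreover have "arrangement l S" using A S by (rule arrangement_subset)
  moreover have "g ` S \<subseteq> B" using S image_arrangement by blast
  then have "arrangement m (g ` S)" by (rule arrangement_subset[OF B])
  ultimately show ?thesis by (simp add: rk_eq_card_iff)
qed

text \<open>Each \<open>X \<inter> H\<close> is itself a lattice element, and \<open>g\<close> is
  injective on the lattice, so it preserves exactly which of these intersections coincide.\<close>

lemma card_restriction_image: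
  assumes S: "S \<subseteq> A" and H: "H \<in> A"
  shows "card (restriction (g ` S) (g H)) = card (restriction S H)"
proof -
  have *: "X \<inter> H \<in> L \<and> g (X \<inter> H) = g X \<inter> g H" if "X \<in> S" for X
  proof -
    have XA: "{X, H} \<subseteq> A" using that S H by blast
    then have "hyperplane l X" "hyperplane m (g X)"
      using A B by (auto simp: arrangement_def simp flip: image_arrangement)
    then have "X \<subseteq> carrier_vec l" "g X \<subseteq> carrier_vec m"
      by (simp_all add: hyperplane_subset_carrier)
    \<comment> \<open>Hyperplanes lie in the ambient space, so the extra \<open>carrier_vec\<close>
      in \<open>intersection\<close> disappears.\<close>
    then have "intersection l {X, H} = X \<inter> H" "intersection m (g ` {X, H}) = g X \<inter> g H"
      by (auto simp: intersection_def)
    then show ?thesis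
      using image_intersection[OF XA] intersection_in_L[OF XA] by simp
  qed
  have "restriction (g ` S) (g H) = g ` restriction S H"
  proof -
    have "restriction (g ` S) (g H) = (\<lambda>X. g X \<inter> g H) ` S" by (auto simp: restriction_def)
    also have "\<dots> = (\<lambda>X. g (X \<inter> H)) ` S" using * by (intro image_cong) auto
    also have "\<dots> = g ` restriction S H" by (auto simp: restriction_def)
    finally show ?thesis .
  qed
  moreover have "restriction S H \<subseteq> L" using * by (auto simp: restriction_def)
  then have "inj_on g (restriction S H)" using bij by (auto simp: bij_betw_def intro: inj_on_subset)
  ultimately show ?thesis by (simp add: card_image)
qed

lemma ordered_partition_image:
  assumes "ordered_partition A p"
  shows "ordered_partition B (map ((`) g) p)"
proof -
  have "distinct p" and p: "partition_on A (set p)" using assms by (simp_all add: ordered_partition_def)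
  have "\<Union> (set p) = A" using p by (simp add: partition_on_def)
  \<comment> \<open>Distinct blocks have distinct images because \<open>g\<close> is injective on
    the union of all blocks.\<close>
  then have "inj_on ((`) g) (set p)"
    using inj_on_A by (intro inj_on_image) simp
  moreover have nonempty: "{} \<notin> (`) g ` set p" using partition_onD3[OF p] by auto
  ultimately show ?thesis
    using \<open>distinct p\<close> partition_on_inj_image[OF p inj_on_A] nonempty
    by (simp add: ordered_partition_def distinct_map image_arrangement)
qed

lemma mat_star_partition_image:
  assumes p: "mat_star_partition l A p"
  shows "mat_star_partition m B (map ((`) g) p)"
  unfolding mat_star_partition_def Let_def
proof (intro conjI allI impI)
  have op: "ordered_partition A p" using p by (simp add: mat_star_partition_def)
  then show "ordered_partition B (map ((`) g) p)" by (rule ordered_partition_image)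
  fix k assume "k < length (map ((`) g) p)"
  then have k: "k < length p" by simp
  define Ak where "Ak = \<Union>(set (take k p))"
  have U: "\<Union>(set p) = A" using op by (simp add: ordered_partition_def partition_on_def)
  have AkA: "Ak \<subseteq> A" unfolding Ak_def U[symmetric] by (auto dest: in_set_takeD)
  have pA: "p ! k \<subseteq> A" unfolding U[symmetric] using k by (intro Union_upper) simp
  \<comment> \<open>The initial unions of the image partition are the images of the initial unions,
    so all three conditions can be compared block by block.\<close>
  have Ak: "\<Union>(set (take k (map ((`) g) p))) = g ` Ak" by (auto simp: Ak_def take_map)
  have pk: "map ((`) g) p ! k = g ` (p ! k)" using k by simp
  have mat: "rk l (p ! k) = card (p ! k)" "\<And>H. H \<in> Ak \<Longrightarrow> \<not> intersection l (p ! k) \<subseteq> H"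
      "\<And>H. H \<in> p ! k \<Longrightarrow> int (card Ak) - int (card (restriction Ak H)) = int k"
    using p k unfolding mat_star_partition_def Let_def Ak_def by blast+
  show "rk m (map ((`) g) p ! k) = card (map ((`) g) p ! k)"
    unfolding pk using mat(1) by (simp add: rk_image_eq_card_iff[OF pA])
  show "\<forall>H'\<in>\<Union>(set (take k (map ((`) g) p))). \<not> intersection m (map ((`) g) p ! k) \<subseteq> H'"
    unfolding pk Ak using mat(2) AkA by (auto simp: image_intersection_subset_iff[OF pA])
  \<comment> \<open>For (c), both cardinalities are preserved separately, so their difference is
    still \<open>k\<close>.\<close>
  show "\<forall>H\<in>map ((`) g) p ! k. int (card (\<Union>(set (take k (map ((`) g) p))))) -
      int (card (restriction (\<Union>(set (take k (map ((`) g) p)))) H)) = int k"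
    unfolding pk Ak using mat(3) pA
    by (auto simp: card_image_block[OF AkA] card_restriction_image[OF AkA] subset_iff)
qed

end

theorem theorem3p3:
  fixes l m :: nat
    and A :: "'a::field vec set set"
    and B :: "'b::field vec set set"
  assumes "mat_star_free l A"
    and "arrangement m B"
    and "lattice_isomorphic (intersection_lattice m B) (intersection_lattice l A)"
  shows "mat_star_free m B"
proof -
  obtain g where "bij_betw g (intersection_lattice l A) (intersection_lattice m B)"
      "\<forall>X\<in>intersection_lattice l A. \<forall>Y\<in>intersection_lattice l A. X \<supseteq> Y \<longleftrightarrow> g X \<supseteq> g Y"
    \<comment> \<open>The given isomorphism runs from the lattice of \<open>B\<close> to that of
      \<open>A\<close> and has to be inverted first.\<close>
    using lattice_isomorphic_sym[OF assms(3)] by (auto simp: lattice_isomorphic_def)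
  moreover obtain p where "arrangement l A" and p: "mat_star_partition l A p"
    using assms(1) by (auto simp: mat_star_free_def)
  ultimately interpret arrangement_iso l m A B g
    using assms(2) by unfold_locales auto
  show ?thesis
    using assms(2) mat_star_partition_image[OF p] by (auto simp: mat_star_free_def)
qed

end
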